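(* The product $\cdot$ on the integers is a full operation $\mathbb Z\to\{\cdot x\}$, where $\{\cdot x\}$ is the collection of functions $\cdot x$ ($a\mapsto a\cdot x$). Every $\cdot x$ determines a functor from $\mathbb Z$ to itself. Furthermore, the product operation is commutative and associative.
   Context: $\mathbb Z$ is the additive group of integers, regarded as an algebraic category: it has one object and its arrows are the integers, composed by $+$; thus "$\cdot x$ is a functor from $\mathbb Z$ to itself" means that $(a+b)\cdot x=(a\cdot x)+(b\cdot x)$ for all integers $a,b$ and that $0\cdot x=0$. The product is defined recursively from the sum: $a\cdot 0:=0$; $a\cdot(x+1):=(a\cdot x)+a$ for $x\ge 0$; and $a\cdot(x-1):=(a\cdot x)-a$ for $x\le 0$. An operation is full if each function it assigns has the whole collection as domain. *)

theory Defs
  imports Main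
begin

(* Graph of the recursively defined product: product_graph a x c reads "a . x = c".
   That the clauses determine exactly one value for all integers a, x is not built in;
   it is what fullness of the operation asserts. *)
inductive product_graph :: "int \<Rightarrow> int \<Rightarrow> int \<Rightarrow> bool" where
  zero: "product_graph a 0 0"
| up: "x \<ge> 0 \<Longrightarrow> product_graph a x c \<Longrightarrow> product_graph a (x + 1) (c + a)"
| down: "x \<le> 0 \<Longrightarrow> product_graph a x c \<Longrightarrow> product_graph a (x - 1) (c - a)"

(* The operation assigns to x the partial function a |-> a . x, defined where the
   recursion yields exactly one value. Note the order of the arguments: x comes first. *)
definition product :: "int \<Rightarrow> (int \<rightharpoonup> int)" where
  "product x = (\<lambda>a. if \<exists>!c. product_graph a x c
                     then Some (THE c. product_graph a x c) else None)"

(* Meaningful only where product x a is defined. *)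
definition int_mult :: "int \<Rightarrow> int \<Rightarrow> int" (infixl "\<odot>" 70) where
  "a \<odot> x = the (product x a)"

(* An operation Z -> F on a collection Z assigns to each x in Z a (possibly partial)
   function in F from Z to Z; it is full if all these functions have domain Z. *)
definition full_operation :: "'a set \<Rightarrow> ('a \<Rightarrow> ('a \<rightharpoonup> 'a)) \<Rightarrow> ('a \<rightharpoonup> 'a) set \<Rightarrow> bool" where
  "full_operation Z f F \<longleftrightarrow> f ` Z \<subseteq> F \<and> (\<forall>x\<in>Z. dom (f x) = Z \<and> ran (f x) \<subseteq> Z)"

(* Functor from the one-object category with arrows the integers, composition + and
   identity arrow 0, to itself, given by its action on arrows (the action on the object
   is forced). The second conjunct makes f total. *)
definition int_functor :: "(int \<rightharpoonup> int) \<Rightarrow> bool" where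
  "int_functor f \<longleftrightarrow> f 0 = Some 0 \<and>
     (\<forall>a b. \<exists>c d. f a = Some c \<and> f b = Some d \<and> f (a + b) = Some (c + d))"

end

theory Submission
  imports Defs
begin

text \<open>
  The recursion computes the ring multiplication of \<^typ>\<open>int\<close>: each of its three clauses
  is an instance of \<open>a * 0 = 0\<close> or of distributivity, so no value other than \<open>a * x\<close> can be
  derived, and stepping away from \<open>0\<close> in either direction reaches every \<open>x\<close>, so a value is
  always derived. Hence the product is total and agrees with \<open>(*)\<close>. The functor
  laws are then distributivity in the left factor, and commutativity and associativity are
  those of the ring of integers.
\<close>

lemma product_graph_sound: "product_graph a x c \<Longrightarrow> c = a * x"
  by (induction rule: product_graph.induct) (simp_all add: algebra_simps)

text \<open>
  Induction in both directions from \<open>0\<close> matches the side conditions \<open>x \<ge> 0\<close> and \<open>x \<le> 0\<close> of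
  the recursion: the upward clause is only ever needed on the nonnegative side, and the
  downward clause on the nonpositive side.
\<close>

lemma product_graph_complete: "product_graph a x (a * x)"
proof (induction x rule: int_induct[where k = 0])
  case base
  show ?case using product_graph.zero by simp
next
  case (step1 x)
  then show ?case using product_graph.up[of x a "a * x"] by (simp add: algebra_simps)
next
  case (step2 x)
  then show ?case using product_graph.down[of x a "a * x"] by (simp add: algebra_simps)
qed

lemma product_graph_eq: "product_graph a x = (\<lambda>c. c = a * x)"
  using product_graph_sound product_graph_complete by blast

lemma product_eq: "product x = (\<lambda>a. Some (a * x))"
  by (simp add: product_def product_graph_eq)

lemma int_mult_eq: "a \<odot> x = a * x"
  by (simp add: int_mult_def product_eq)

lemma full_operation_product: "full_operation UNIV product {product x | x. True}"
  by (auto simp: full_operation_def product_eq dom_def)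

lemma int_functor_product: "int_functor (product x)"
  by (simp add: int_functor_def product_eq distrib_right)

theorem theorem7p1:
  shows "full_operation (UNIV :: int set) product {product x | x. True}
    \<and> (\<forall>x. int_functor (product x))
    \<and> (\<forall>a b. a \<odot> b = b \<odot> a)
    \<and> (\<forall>a b c. (a \<odot> b) \<odot> c = a \<odot> (b \<odot> c))"
  using full_operation_product int_functor_product
  by (simp add: int_mult_eq mult.commute mult.assoc)

end
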